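(* Let $X$ and $Y$ be vector lattices and let $T\colon X\to Y$ be a map. Suppose that there exists a function $g\colon X\to Y_+$ such that $$|T(x)-T(y)|=g(x-y)\qquad\text{for all } x,y\in X.$$ Then $T$ is $\mathbb{Q}$-affine. Furthermore, if $g(|x|)=g(x)$ for all $x\in X$, then $T-T(0)$ is disjointness preserving.
   Context: All vector spaces are real and nontrivial. Maps are not assumed linear or affine unless stated. A *vector lattice* is a vector space with a partial order compatible with the linear structure ($x\le y$ implies $x+z\le y+z$ and $ax\le ay$ for real $a\ge 0$) in which every pair $x,y$ has a supremum $x\vee y$ and an infimum $x\wedge y$. Put $|x|:=x\vee(-x)$ and $Y_+:=\{y\in Y: y\ge 0\}$. Vectors $x,y$ are *disjoint*, written $x\perp y$, if $|x|\wedge|y|=0$. A map $U$ between vector lattices is *disjointness preserving* if $x\perp y$ implies $U(x)\perp U(y)$. A map $U\colon X\to Y$ between vector spaces is *$\mathbb{Q}$-linear* if $U(px+qy)=pU(x)+qU(y)$ for all $p,q\in\mathbb{Q}$ and $x,y\in X$. A map $T$ is *$\mathbb{Q}$-affine* if $T-T(0)\colon x\mapsto T(x)-T(0)$ is $\mathbb{Q}$-linear. *)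

theory Defs
  imports Complex_Main "HOL-Library.Lattice_Algebras"
begin

(* The superclass lattice_ab_group_add_abs fixes \<bar>x\<bar> = sup x (- x). Nontriviality of the
   space is not part of the class. *)
class vector_lattice = ordered_real_vector + lattice_ab_group_add_abs

definition disjoint_vec :: "'a::vector_lattice \<Rightarrow> 'a \<Rightarrow> bool"
  where "disjoint_vec x y \<longleftrightarrow> inf \<bar>x\<bar> \<bar>y\<bar> = 0"

definition disjointness_preserving :: "('a::vector_lattice \<Rightarrow> 'b::vector_lattice) \<Rightarrow> bool"
  where "disjointness_preserving U \<longleftrightarrow> (\<forall>x y. disjoint_vec x y \<longrightarrow> disjoint_vec (U x) (U y))"

definition rat_linear :: "('a::real_vector \<Rightarrow> 'b::real_vector) \<Rightarrow> bool"
  where "rat_linear U \<longleftrightarrow>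
    (\<forall>p\<in>\<rat>. \<forall>q\<in>\<rat>. \<forall>x y. U (p *\<^sub>R x + q *\<^sub>R y) = p *\<^sub>R U x + q *\<^sub>R U y)"

definition rat_affine :: "('a::real_vector \<Rightarrow> 'b::real_vector) \<Rightarrow> bool"
  where "rat_affine T \<longleftrightarrow> rat_linear (\<lambda>x. T x - T 0)"

end

theory Submission
  imports Defs
begin

text \<open>
  Two vectors have the same modulus iff their sum and difference are disjoint, so every
  identity \<open>\<bar>T x - T y\<bar> = g (x - y)\<close> becomes a disjointness relation. As the disjoint
  complement of a vector is a subspace, suitable linear combinations of these relations show that
  the defects \<open>S x + S (- x)\<close> and \<open>S (x + y) - S x - S y\<close> of \<open>S = T - T 0\<close>
  are disjoint from themselves, hence zero. Oddness needs divisibility of the domain: on the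
  integers, the parity map satisfies the hypothesis without being odd.
\<close>

text \<open>For \<open>t = inf (x + y) z\<close>, both \<open>x\<close> and \<open>z\<close>
  dominate \<open>t - y\<close>, so \<open>t\<close> lies below \<open>y\<close> as well as below
  \<open>z\<close>, whose infimum is zero.\<close>

lemma inf_add_eq_0:
  fixes x y z :: "'a::lattice_ab_group_add"
  assumes "0 \<le> x" "0 \<le> y" "0 \<le> z" "inf x z = 0" "inf y z = 0"
  shows "inf (x + y) z = 0"
proof (rule antisym)
  let ?t = "inf (x + y) z"
  have "?t - y \<le> x"
    by (simp add: diff_le_eq)
  moreover have "?t - y \<le> z"
    using assms(2) by (simp add: diff_le_eq le_infI2 add_increasing2)
  ultimately have "?t - y \<le> inf x z"
    by simp
  then have "?t \<le> y"
    using assms by simp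
  then have "?t \<le> inf y z"
    by simp
  then show "?t \<le> 0"
    using assms by simp
  show "0 \<le> ?t"
    using assms by simp
qed

lemma inf_eq_0_mono:
  fixes x y z :: "'a::lattice_ab_group_add"
  assumes "0 \<le> x" "x \<le> y" "0 \<le> z" "inf y z = 0"
  shows "inf x z = 0"
proof (rule antisym)
  show "inf x z \<le> 0"
    using inf_mono[OF assms(2) order_refl, of z] assms(4) by simp
  show "0 \<le> inf x z"
    using assms by simp
qed

text \<open>The modulus is \<open>sup x y - inf x y\<close>, and
  \<open>x + y = sup x y + inf x y\<close> eliminates the supremum. Comparing moduli thus reduces to
  comparing infima.\<close>

lemma abs_diff_eq_inf:
  fixes x y :: "'a::lattice_ab_group_add_abs"
  shows "\<bar>x - y\<bar> = x + y - (inf x y + inf x y)"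
proof -
  have "pprt (x - y) + y = sup x y" "nprt (x - y) + y = inf x y"
    by (simp_all add: pprt_def nprt_def add_sup_distrib_right add_inf_distrib_right)
  then have "\<bar>x - y\<bar> = sup x y - inf x y"
    unfolding abs_prts by (metis add_diff_cancel_right)
  then show ?thesis
    using add_eq_inf_sup[of x y] by (simp add: algebra_simps)
qed

lemma disjoint_vec_commute: "disjoint_vec x y \<longleftrightarrow> disjoint_vec y x"
  by (simp add: disjoint_vec_def inf_commute)

lemma disjoint_vec_self: "disjoint_vec x x \<Longrightarrow> x = 0"
  by (simp add: disjoint_vec_def)

lemma disjoint_vec_cong_abs: "\<bar>x\<bar> = \<bar>y\<bar> \<Longrightarrow> disjoint_vec x z \<Longrightarrow> disjoint_vec y z"
  by (simp add: disjoint_vec_def)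

lemma disjoint_vec_uminus: "disjoint_vec x z \<Longrightarrow> disjoint_vec (- x) z"
  by (simp add: disjoint_vec_def)

lemma disjoint_vec_mono:
  assumes "\<bar>x\<bar> \<le> \<bar>y\<bar>" "disjoint_vec y z"
  shows "disjoint_vec x z"
  using assms inf_eq_0_mono[of "\<bar>x\<bar>" "\<bar>y\<bar>" "\<bar>z\<bar>"] by (simp add: disjoint_vec_def)

lemma disjoint_vec_add:
  assumes "disjoint_vec x z" "disjoint_vec y z"
  shows "disjoint_vec (x + y) z"
proof -
  have "inf (\<bar>x\<bar> + \<bar>y\<bar>) \<bar>z\<bar> = 0"
    using assms by (intro inf_add_eq_0) (auto simp: disjoint_vec_def)
  then show ?thesis
    unfolding disjoint_vec_def
    by (rule inf_eq_0_mono[rotated 3]) (auto simp: abs_triangle_ineq)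
qed

lemma disjoint_vec_diff:
  "disjoint_vec x z \<Longrightarrow> disjoint_vec y z \<Longrightarrow> disjoint_vec (x - y) z"
  using disjoint_vec_add[of x z "- y"] disjoint_vec_uminus[of y z] by simp

lemma abs_double:
  fixes x :: "'a::lattice_ab_group_add_abs"
  shows "\<bar>x + x\<bar> = \<bar>x\<bar> + \<bar>x\<bar>"
proof -
  have "inf x (- x) = - \<bar>x\<bar>"
    by (metis abs_lattice minus_minus neg_inf_eq_sup sup_commute)
  then show ?thesis
    using abs_diff_eq_inf[of x "- x"] by simp
qed

lemma disjoint_vec_half: "disjoint_vec (x + x) z \<Longrightarrow> disjoint_vec x z"
  by (rule disjoint_vec_mono[of x "x + x"]) (simp_all add: abs_double)

text \<open>With \<open>u = p - q\<close> and \<open>v = r - s\<close> split into positive and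
  negative parts, both moduli equal \<open>p + q + r + s\<close> minus twice an infimum,
  \<open>I\<close> for the sum and \<open>J\<close> for the difference. They agree iff
  \<open>I = J\<close>, which turns out to force \<open>I = J = 0\<close>, that is, disjointness of
  all parts.\<close>

lemma abs_add_eq_abs_diff_iff_disjoint_vec:
  fixes u v :: "'a::vector_lattice"
  shows "\<bar>u + v\<bar> = \<bar>u - v\<bar> \<longleftrightarrow> disjoint_vec u v"
proof -
  define p q r s where pqrs: "p = pprt u" "q = - nprt u" "r = pprt v" "s = - nprt v"
  have nonneg: "0 \<le> p" "0 \<le> q" "0 \<le> r" "0 \<le> s"
    by (simp_all add: pqrs)
  have u: "u = p - q" and v: "v = r - s"
    by (simp_all add: pqrs flip: prts)
  have abs_u: "\<bar>u\<bar> = p + q" and abs_v: "\<bar>v\<bar> = r + s"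
    by (simp_all add: pqrs abs_prts)
  have pq: "inf p q = 0" and rs: "inf r s = 0"
  proof -
    have zero: "t = 0" if "b = b - (t + t)" for b t :: 'a
      using that by (metis diff_add_cancel add_cancel_left_right double_zero)
    \<comment> \<open>The modulus of \<open>p - q\<close> is \<open>p + q\<close>, but by
      \<open>abs_diff_eq_inf\<close> also \<open>p + q\<close> minus twice
      \<open>inf p q\<close>.\<close>
    show "inf p q = 0" "inf r s = 0"
      using zero abs_diff_eq_inf[of p q] abs_diff_eq_inf[of r s] abs_u abs_v u v by metis+
  qed
  define I J where IJ: "I = inf (p + r) (q + s)" "J = inf (p + s) (q + r)"
  have nonneg_IJ: "0 \<le> I" "0 \<le> J"
    using nonneg by (simp_all add: IJ)
  have add: "\<bar>u + v\<bar> = (p + q + r + s) - (I + I)"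
    using abs_diff_eq_inf[of "p + r" "q + s"] by (simp add: u v IJ algebra_simps)
  have diff: "\<bar>u - v\<bar> = (p + q + r + s) - (J + J)"
    using abs_diff_eq_inf[of "p + s" "q + r"] by (simp add: u v IJ algebra_simps)
  show ?thesis
  proof
    assume "\<bar>u + v\<bar> = \<bar>u - v\<bar>"
    then have "(I - J) + (I - J) = 0"
      using add diff by (simp add: algebra_simps)
    then have "I = J"
      by (simp only: double_zero right_minus_eq)
    have "I \<le> p + r" "I \<le> q + s" "J \<le> p + s" "J \<le> q + r"
      by (simp_all add: IJ)
    \<comment> \<open>These infima are \<open>p + inf r s = p\<close> and
      \<open>q + inf r s = q\<close>, so the common value lies below
      \<open>inf p q = 0\<close>.\<close>
    then have "I \<le> inf (p + r) (p + s)" "I \<le> inf (q + s) (q + r)"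
      unfolding \<open>I = J\<close> by (auto intro: le_infI)
    then have "I \<le> p" "I \<le> q"
      using rs by (simp_all add: add_inf_distrib_left[symmetric] inf_commute)
    then have "I \<le> 0"
      using le_infI[of I p q] pq by simp
    then have 0: "inf (p + r) (q + s) = 0" "inf (p + s) (q + r) = 0"
      using nonneg_IJ(1) \<open>I = J\<close> by (auto simp flip: IJ)
    have "inf p (r + s) = 0" "inf q (r + s) = 0"
    proof -
      \<comment> \<open>Dropping nonnegative summands only shrinks an infimum, so each of these lies
        between 0 and \<open>I\<close> or \<open>J\<close>.\<close>
      have "inf s p = 0" "inf r q = 0" "inf r p = 0" "inf s q = 0"
        using 0 nonneg inf_mono[of s "q + s" p "p + r"] inf_mono[of r "p + r" q "q + s"]
          inf_mono[of r "q + r" p "p + s"] inf_mono[of s "p + s" q "q + r"]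
        by (auto simp: inf_commute intro!: antisym)
      then show "inf p (r + s) = 0" "inf q (r + s) = 0"
        using nonneg inf_add_eq_0[of r s p] inf_add_eq_0[of r s q] by (simp_all add: inf_commute)
    qed
    then show "disjoint_vec u v"
      using nonneg by (simp add: disjoint_vec_def abs_u abs_v inf_add_eq_0)
  next
    assume "disjoint_vec u v"
    then have uv: "inf (p + q) (r + s) = 0"
      by (simp add: disjoint_vec_def abs_u abs_v)
    have cross: "inf a b = 0" if "0 \<le> a" "a \<le> p + q" "0 \<le> b" "b \<le> r + s" for a b
      using uv that inf_mono[of a "p + q" b "r + s"] by (simp add: antisym)
    have "inf p s = 0" "inf r q = 0" "inf p r = 0" "inf s q = 0"
      using nonneg cross[of p s] cross[of q r] cross[of p r] cross[of q s]
      by (simp_all add: inf_commute)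
    then have "inf p (q + s) = 0" "inf r (q + s) = 0" "inf p (q + r) = 0" "inf s (q + r) = 0"
      using nonneg pq rs inf_add_eq_0[of q s p] inf_add_eq_0[of q s r] inf_add_eq_0[of q r p]
        inf_add_eq_0[of q r s]
      by (simp_all add: inf_commute)
    then have "I = 0" "J = 0"
      unfolding IJ using nonneg by (simp_all add: inf_add_eq_0)
    then show "\<bar>u + v\<bar> = \<bar>u - v\<bar>"
      by (simp add: add diff)
  qed
qed

text \<open>The sum and the difference of \<open>u + v\<close> and \<open>u - v\<close> are
  \<open>u + u\<close> and \<open>v + v\<close>, which have equal moduli.\<close>

lemma abs_eq_imp_disjoint_vec:
  fixes u v :: "'a::vector_lattice"
  assumes "\<bar>u\<bar> = \<bar>v\<bar>"
  shows "disjoint_vec (u + v) (u - v)"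
proof -
  have "\<bar>(u + v) + (u - v)\<bar> = \<bar>u\<bar> + \<bar>u\<bar>" "\<bar>(u + v) - (u - v)\<bar> = \<bar>v\<bar> + \<bar>v\<bar>"
    by (simp_all add: abs_double)
  then show ?thesis
    using assms by (simp only: abs_add_eq_abs_diff_iff_disjoint_vec[symmetric])
qed

text \<open>Disjointness from \<open>S x\<close> is shown for three vectors built from the half
  \<open>y\<close> of \<open>x\<close>; combining them cancels \<open>S y\<close> and
  \<open>S (- y)\<close> and leaves \<open>S x + S (- x)\<close>.\<close>

lemma odd_if_abs_diff_eq:
  fixes S :: "'a::real_vector \<Rightarrow> 'b::vector_lattice"
  assumes S: "\<And>x y. \<bar>S x - S y\<bar> = \<bar>S (x - y)\<bar>"
  shows "S (- x) = - S x"
proof -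
  \<comment> \<open>The pair \<open>0, 0\<close> gives \<open>S 0 = 0\<close>; the pair
    \<open>0, x\<close> then gives the claim.\<close>
  have abs_minus: "\<bar>S (- x)\<bar> = \<bar>S x\<bar>" for x
    using S[of 0 0] S[of 0 x] by simp
  define y where "y = (1/2) *\<^sub>R x"
  have x: "x = y + y"
    by (simp add: y_def scaleR_2[symmetric])
  have half: "disjoint_vec (S (z + z)) (S (z + z) - (S z + S z))" for z
    using abs_eq_imp_disjoint_vec[of "S (z + z) - S z" "S z"] S[of "z + z" z]
    by (simp add: algebra_simps)
  have 1: "disjoint_vec (S x - (S y + S y)) (S x)"
    using half[of y] by (simp add: x disjoint_vec_commute)
  have "disjoint_vec (S (- x)) (S (- x) - (S (- y) + S (- y)))"
    using half[of "- y"] by (simp add: x)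
  then have 2: "disjoint_vec (S (- x) - (S (- y) + S (- y))) (S x)"
    using disjoint_vec_cong_abs[OF abs_minus] disjoint_vec_commute by blast
  have "disjoint_vec (S y - S (- y)) (S y + S (- y))"
    using abs_eq_imp_disjoint_vec[of "S y" "S (- y)"] abs_minus[of y] disjoint_vec_commute by auto
  \<comment> \<open>The hypothesis at \<open>y\<close> and \<open>- y\<close> gives
    \<open>S y - S (- y)\<close> the modulus of \<open>S x\<close>.\<close>
  then have 3: "disjoint_vec (S y + S (- y)) (S x)"
    using disjoint_vec_cong_abs S[of y "- y"] x disjoint_vec_commute
    by (metis diff_minus_eq_add)
  have "disjoint_vec (S x + S (- x)) (S x)"
    using disjoint_vec_add[OF disjoint_vec_add[OF 1 2] disjoint_vec_add[OF 3 3]]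
    by (simp add: algebra_simps)
  moreover from this have "disjoint_vec (S x + S (- x)) (S (- x))"
    using abs_minus[of x] by (simp add: disjoint_vec_def)
  ultimately have "disjoint_vec (S x + S (- x)) (S x + S (- x))"
    using disjoint_vec_add disjoint_vec_commute by blast
  then have "S x + S (- x) = 0"
    by (rule disjoint_vec_self)
  then show ?thesis
    by (simp add: eq_neg_iff_add_eq_0 add.commute)
qed

text \<open>Three equalities of moduli, the first relying on oddness, make the defect
  \<open>?d\<close> disjoint from three combinations of \<open>S (x + y)\<close>, \<open>S x\<close>
  and \<open>S y\<close>. Their span contains \<open>?d\<close> itself.\<close>

lemma additive_if_abs_diff_eq:
  fixes S :: "'a::real_vector \<Rightarrow> 'b::vector_lattice"
  assumes S: "\<And>x y. \<bar>S x - S y\<bar> = \<bar>S (x - y)\<bar>"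
  shows "additive S"
proof
  fix x y
  let ?d = "S (x + y) - S x - S y"
  have "\<bar>S (x + y)\<bar> = \<bar>S x + S y\<bar>"
    using S[of x "- y"] odd_if_abs_diff_eq[of S y] S by simp
  from abs_eq_imp_disjoint_vec[OF this] have 1: "disjoint_vec (S (x + y) + S x + S y) ?d"
    by (simp add: algebra_simps)
  have "\<bar>S (x + y) - S x\<bar> = \<bar>S y\<bar>"
    using S[of "x + y" x] by simp
  from abs_eq_imp_disjoint_vec[OF this] have 2: "disjoint_vec (S (x + y) - S x + S y) ?d"
    by (simp add: algebra_simps)
  have "\<bar>S (x + y) - S y\<bar> = \<bar>S x\<bar>"
    using S[of "x + y" y] by simp
  from abs_eq_imp_disjoint_vec[OF this] have 3: "disjoint_vec (S (x + y) - S y + S x) ?d"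
    by (simp add: algebra_simps)
  have "disjoint_vec (S (x + y) + S (x + y)) ?d"
    using disjoint_vec_add[OF 2 3] by (simp add: algebra_simps)
  then have 4: "disjoint_vec (S (x + y)) ?d"
    by (rule disjoint_vec_half)
  have "disjoint_vec (S (x + y) + S (x + y) - (S (x + y) + S x + S y)) ?d"
    using disjoint_vec_diff[OF disjoint_vec_add[OF 4 4] 1] .
  then have "disjoint_vec ?d ?d"
    by (simp add: algebra_simps)
  then have "?d = 0"
    by (rule disjoint_vec_self)
  then show "S (x + y) = S x + S y"
    by (simp add: algebra_simps)
qed

lemma rat_linear_if_additive:
  fixes S :: "'a::real_vector \<Rightarrow> 'b::real_vector"
  assumes "additive S"
  shows "rat_linear S"
proof -
  interpret additive S by fact
  have nat: "S (real n *\<^sub>R x) = real n *\<^sub>R S x" for n x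
    by (induction n) (simp_all add: zero add scaleR_left_distrib)
  have int: "S (real_of_int k *\<^sub>R x) = real_of_int k *\<^sub>R S x" for k x
    by (cases k rule: int_cases2) (simp_all add: nat minus)
  have "S (q *\<^sub>R x) = q *\<^sub>R S x" if "q \<in> \<rat>" for q x
  proof -
    obtain a b where q: "q = real_of_int a / real_of_int b" "b > 0"
      using \<open>q \<in> \<rat>\<close> by (rule Rats_cases')
    \<comment> \<open>Multiplying by the denominator leaves only integer multiples; \<open>b\<close>
      is cancelled at the end.\<close>
    have "real_of_int b *\<^sub>R S (q *\<^sub>R x) = real_of_int a *\<^sub>R S x"
      using q int[of b "q *\<^sub>R x"] int[of a x] by simp
    also have "\<dots> = real_of_int b *\<^sub>R q *\<^sub>R S x"
      using q by simp
    finally show ?thesis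
      using q(2) by (subst (asm) scaleR_cancel_left) simp
  qed
  then show ?thesis
    by (simp add: rat_linear_def add)
qed

theorem theorem3p2:
  fixes T g :: "'a::vector_lattice \<Rightarrow> 'b::vector_lattice"
  assumes nontrivial_X: "\<exists>x::'a. x \<noteq> 0"
    and nontrivial_Y: "\<exists>y::'b. y \<noteq> 0"
    and g_nonneg: "\<And>x. 0 \<le> g x"
    and T_g: "\<And>x y. \<bar>T x - T y\<bar> = g (x - y)"
  shows "rat_affine T \<and>
    ((\<forall>x. g \<bar>x\<bar> = g x) \<longrightarrow> disjointness_preserving (\<lambda>x. T x - T 0))"
proof -
  define S where "S = (\<lambda>x. T x - T 0)"
  \<comment> \<open>Setting the second argument to 0 determines \<open>g\<close>, so the hypothesis
    becomes one on \<open>S\<close> alone.\<close>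
  have g: "g x = \<bar>S x\<bar>" for x
    using T_g[of x 0] by (simp add: S_def)
  have "\<bar>S x - S y\<bar> = \<bar>S (x - y)\<bar>" for x y
    using T_g[of x y] g[of "x - y"] by (simp add: S_def)
  then have S: "additive S"
    by (rule additive_if_abs_diff_eq)
  have "disjoint_vec (S x) (S y)" if "\<forall>x. g \<bar>x\<bar> = g x" "disjoint_vec x y" for x y
  proof -
    \<comment> \<open>The criterion is used in both spaces: \<open>g\<close> carries equality of
      moduli from the domain to the codomain, where additivity of \<open>S\<close> turns it back
      into disjointness.\<close>
    have "\<bar>x + y\<bar> = \<bar>x - y\<bar>"
      using that by (simp add: abs_add_eq_abs_diff_iff_disjoint_vec)
    then have "\<bar>S (x + y)\<bar> = \<bar>S (x - y)\<bar>"
      using that(1) by (metis g)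
    then show ?thesis
      using S by (simp add: additive.add additive.diff abs_add_eq_abs_diff_iff_disjoint_vec)
  qed
  then show ?thesis
    using rat_linear_if_additive[OF S]
    by (simp add: rat_affine_def disjointness_preserving_def flip: S_def)
qed

end
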